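(* Let $K_1$ and $K_2$ be closed convex sets in a real Hilbert space $X$ such that $K:=K_1\cap K_2\neq\emptyset$, and let $x_0\in X$. Let $\{x_i\}$ be the iterates of the modified alternating projection algorithm (described in the context) started at $x_0$, with either the choice $J_i=\{[i]\}$ for all $i\geq 1$, or the choice $J_i=\{1,2\}$ for all $i\geq1$. Then $x_i$ converges weakly to some $z\in X$. The convergence is strong if either $\operatorname{int}(K)\neq\emptyset$ or $X=\mathbb{R}^n$.
   Context: $P_C$ denotes the metric projection onto a nonempty closed convex set $C$. For an integer $i\geq1$, $[i]=1$ if $i$ is odd and $[i]=2$ if $i$ is even. Modified alternating projection algorithm: given $x_0\in X$, for $i=1,2,\dots$ choose $J_i\subset\{1,2\}$; for each $j\in J_i$ set $$x_i^{(j)}=P_{K_j}(x_{i-1}),\quad a_i^{(j)}=x_{i-1}-x_i^{(j)}\in X,\quad b_i^{(j)}=\langle a_i^{(j)},x_i^{(j)}\rangle\in\mathbb{R};$$ define $$F_i:=\begin{cases}\{x\mid\langle a_l^{([l])},x\rangle\leq b_l^{([l])}\text{ for } l=i-1,i\} & \text{if } J_i=\{[i]\}\text{ and } i>1,\\ \{x\mid\langle a_1^{(1)},x\rangle\leq b_1^{(1)}\} & \text{if } J_i=\{[i]\}\text{ and } i=1,\\ \{x\mid\langle a_i^{(j)},x\rangle\leq b_i^{(j)}\text{ for } j=1,2\} & \text{if } J_i=\{1,2\},\end{cases}$$ and set $x_i=P_{F_i}(x_i^{([i])})$. *)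

theory Defs
  imports "HOL-Analysis.Analysis"
begin

text \<open>
  The library's projection \<open>closest_point\<close> is restricted to
  Heine-Borel spaces, which excludes infinite-dimensional Hilbert spaces.
  A real Hilbert space is a type of sort \<open>{real_inner, complete_space}\<close>;
  there the nearest point of a nonempty closed convex set exists and is unique.
\<close>

definition metric_proj :: "'a::real_inner set \<Rightarrow> 'a \<Rightarrow> 'a" where
  "metric_proj C x = (THE p. p \<in> C \<and> (\<forall>y\<in>C. dist x p \<le> dist x y))"

definition weakly_converges :: "(nat \<Rightarrow> 'a::real_normed_vector) \<Rightarrow> 'a \<Rightarrow> bool" where
  "weakly_converges x z \<longleftrightarrow>
    (\<forall>f :: 'a \<Rightarrow> real. bounded_linear f \<longrightarrow> (\<lambda>i. f (x i)) \<longlonglongrightarrow> f z)"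

definition par :: "nat \<Rightarrow> nat" where
  "par i = (if odd i then 1 else 2)"

text \<open>
  \<open>K :: nat \<Rightarrow> 'a set\<close> carries the two sets as \<open>K 1\<close> and \<open>K 2\<close>; \<open>px K x i j\<close>,
  \<open>pa K x i j\<close>, \<open>pb K x i j\<close> are $x_i^{(j)}$, $a_i^{(j)}$, $b_i^{(j)}$.
  They are meaningful for \<open>i \<ge> 1\<close> only.
\<close>

definition px :: "(nat \<Rightarrow> 'a::real_inner set) \<Rightarrow> (nat \<Rightarrow> 'a) \<Rightarrow> nat \<Rightarrow> nat \<Rightarrow> 'a" where
  "px K x i j = metric_proj (K j) (x (i - 1))"

definition pa :: "(nat \<Rightarrow> 'a::real_inner set) \<Rightarrow> (nat \<Rightarrow> 'a) \<Rightarrow> nat \<Rightarrow> nat \<Rightarrow> 'a" where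
  "pa K x i j = x (i - 1) - px K x i j"

definition pb :: "(nat \<Rightarrow> 'a::real_inner set) \<Rightarrow> (nat \<Rightarrow> 'a) \<Rightarrow> nat \<Rightarrow> nat \<Rightarrow> real" where
  "pb K x i j = inner (pa K x i j) (px K x i j)"

text \<open>The algorithm specifies $F_i$ only when $J_i$ is $\{[i]\}$ or $\{1,2\}$.\<close>

definition F_set ::
  "(nat \<Rightarrow> 'a::real_inner set) \<Rightarrow> (nat \<Rightarrow> nat set) \<Rightarrow> (nat \<Rightarrow> 'a) \<Rightarrow> nat \<Rightarrow> 'a set" where
  "F_set K J x i =
    (if J i = {par i} \<and> i > 1 then
       {y. \<forall>l\<in>{i - 1, i}. inner (pa K x l (par l)) y \<le> pb K x l (par l)}
     else if J i = {par i} \<and> i = 1 then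
       {y. inner (pa K x 1 1) y \<le> pb K x 1 1}
     else if J i = {1, 2} then
       {y. \<forall>j\<in>{1, 2}. inner (pa K x i j) y \<le> pb K x i j}
     else undefined)"

definition map_iterates ::
  "(nat \<Rightarrow> 'a::real_inner set) \<Rightarrow> (nat \<Rightarrow> nat set) \<Rightarrow> 'a \<Rightarrow> (nat \<Rightarrow> 'a) \<Rightarrow> bool" where
  "map_iterates K J x0 x \<longleftrightarrow>
    x 0 = x0 \<and> (\<forall>i\<ge>1. x i = metric_proj (F_set K J x i) (px K x i (par i)))"

text \<open>
  \<open>map_iterates\<close> describes the sequence by its recurrence; \<open>F_set K J x i\<close> only uses
  \<open>x (i - 1)\<close> and \<open>x (i - 2)\<close>, so such a sequence exists for all data.
\<close>

lemma F_set_cong: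
  assumes "i \<ge> 1" "x (i - 1) = y (i - 1)" "i > 1 \<Longrightarrow> x (i - 2) = y (i - 2)"
  shows "F_set K J x i = F_set K J y i"
proof -
  have a: "px K x i j = px K y i j" "pa K x i j = pa K y i j" "pb K x i j = pb K y i j" for j
    using assms(2) by (simp_all add: px_def pa_def pb_def)
  have b: "pa K x (i - 1) j = pa K y (i - 1) j" "pb K x (i - 1) j = pb K y (i - 1) j"
    if "i > 1" for j
    using assms(3)[OF that] by (simp_all add: px_def pa_def pb_def numeral_2_eq_2)
  show ?thesis
    unfolding F_set_def using a b by (cases "i = 1") auto
qed

lemma map_iterates_exist: "\<exists>x. map_iterates K J x0 x"
proof -
  define s where "s i u v = (\<lambda>k. if k = i - 1 then v else u)" for i :: nat and u v :: 'a
  define g where "g n q =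
      (snd q, metric_proj (F_set K J (s (Suc n) (fst q) (snd q)) (Suc n))
                          (px K (s (Suc n) (fst q) (snd q)) (Suc n) (par (Suc n))))" for n q
  define p where "p = rec_nat (x0, x0) g"
  define x where "x n = snd (p n)" for n
  have p0: "p 0 = (x0, x0)" and pS: "p (Suc n) = g n (p n)" for n
    by (simp_all add: p_def)
  have "x (Suc n) = metric_proj (F_set K J x (Suc n)) (px K x (Suc n) (par (Suc n)))" for n
  proof -
    have prev: "fst (p n) = x (n - 1)" if "n > 0"
      using that by (cases n) (simp_all add: pS g_def x_def)
    let ?s = "s (Suc n) (fst (p n)) (snd (p n))"
    have "F_set K J ?s (Suc n) = F_set K J x (Suc n)"
      by (rule F_set_cong) (use prev in \<open>auto simp: s_def x_def\<close>)
    moreover have "px K ?s (Suc n) j = px K x (Suc n) j" for j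
      by (simp add: px_def s_def x_def)
    moreover have "x (Suc n) = metric_proj (F_set K J ?s (Suc n)) (px K ?s (Suc n) (par (Suc n)))"
      by (simp add: x_def pS g_def)
    ultimately show ?thesis by simp
  qed
  then have "x i = metric_proj (F_set K J x i) (px K x i (par i))" if "i \<ge> 1" for i
    using that by (cases i) auto
  moreover have "x 0 = x0" by (simp add: x_def p0)
  ultimately show ?thesis unfolding map_iterates_def by blast
qed

end

theory Submission
  imports Defs
begin

text \<open>
  Every linear constraint in \<open>F_set K J x i\<close> is the obtuse-angle inequality at a projection
  \<open>px K x l j\<close> onto \<open>K j\<close>, so it holds on \<open>K j\<close>; hence each \<open>F_set K J x i\<close> is a closed convex
  set containing \<open>K 1 \<inter> K 2\<close>.  One step of the algorithm is thus a composition of two projections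
  onto closed convex supersets of the solution set.  Written as an
  inequality between squared distances
  (\<open>metric_proj_pythagoras\<close>), the obtuse-angle inequality makes the iterates Fejer monotone with respect to
  \<open>K 1 \<inter> K 2\<close>: their distance to each point of it does not increase.  It also bounds the squared
  length of both displacements in a step by the decrease of the squared distance, which tends
  to \<open>0\<close>.  Hence the distances of the iterates to \<open>K 1\<close> and to \<open>K 2\<close> tend to \<open>0\<close>.

  Weak convergence is obtained without weak compactness.  The points common to the closed convex
  hulls of all tails of a sequence take over the role of its weak cluster points: they exist for
  bounded sequences because nested bounded closed convex sets in a Hilbert space meet
  (\<open>nested_closed_convex_Inter_nonempty\<close>), and they satisfy every closed convex constraint that the
  sequence satisfies asymptotically.  For the iterates all of them lie in \<open>K 1 \<inter> K 2\<close>, and Opial's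
  argument (\<open>opial_weak_convergence\<close>) shows that there is only one, which is the weak limit.

  If \<open>K 1 \<inter> K 2\<close> contains a ball, Fejer monotonicity with respect to all its points bounds
  the distance between two iterates by a multiple of the decrease of the squared distance to
  the centre, so the sequence is Cauchy (\<open>fejer_ball_Cauchy\<close>).  In finite dimension weak
  convergence is convergence of coordinates.
\<close>

section \<open>Projections onto closed convex sets in a Hilbert space\<close>

lemma Cauchy_if_dist_power_le:
  fixes x :: "nat \<Rightarrow> 'a::metric_space"
  assumes le: "\<And>m n. m \<le> n \<Longrightarrow> dist (x m) (x n) ^ p \<le> g m"
    and g: "g \<longlonglongrightarrow> (0::real)"
  shows "Cauchy x"
proof (rule metric_CauchyI)
  fix e :: real
  assume e: "0 < e"
  have "eventually (\<lambda>m. g m < e ^ p) sequentially"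
    using order_tendstoD(2)[OF g, of "e ^ p"] e by simp
  then obtain M where M: "\<And>m. m \<ge> M \<Longrightarrow> g m < e ^ p"
    by (auto simp: eventually_sequentially)
  have *: "dist (x m) (x n) < e" if "m \<ge> M" "m \<le> n" for m n
  proof (rule power_less_imp_less_base)
    show "dist (x m) (x n) ^ p < e ^ p"
      using le[OF that(2)] M[OF that(1)] by simp
  qed (use e in simp)
  show "\<exists>M. \<forall>m\<ge>M. \<forall>n\<ge>M. dist (x m) (x n) < e"
    using * by (metis dist_commute nle_le)
qed

text \<open>
  Compactness of balls is replaced by the parallelogram law: the midpoint of two almost nearest
  points is no nearer than the infimum, so almost nearest points are close to each other and a
  minimizing sequence is Cauchy.
\<close>

lemma nearest_point_exists:
  fixes C :: "'a::{real_inner, complete_space} set"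
  assumes "closed C" "convex C" "C \<noteq> {}"
  shows "\<exists>p\<in>C. \<forall>y\<in>C. dist a p \<le> dist a y"
proof -
  define d where "d = infdist a C"
  have d0: "0 \<le> d" by (simp add: d_def infdist_nonneg)
  have lower: "d \<le> dist a y" if "y \<in> C" for y
    unfolding d_def using that by (rule infdist_le)
  have "\<exists>y\<in>C. (dist a y)\<^sup>2 < d\<^sup>2 + 1 / real (Suc n)" for n
  proof -
    have "sqrt (d\<^sup>2) < sqrt (d\<^sup>2 + 1 / real (Suc n))"
      by (rule real_sqrt_less_mono) simp
    then have "infdist a C < sqrt (d\<^sup>2 + 1 / real (Suc n))"
      using d0 by (simp add: d_def)
    then obtain y where y: "y \<in> C" "dist a y < sqrt (d\<^sup>2 + 1 / real (Suc n))"
      using assms(3) by (auto simp: infdist_notempty cINF_less_iff)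
    have "(dist a y)\<^sup>2 < (sqrt (d\<^sup>2 + 1 / real (Suc n)))\<^sup>2"
      by (rule power_strict_mono[OF y(2)]) auto
    then show ?thesis using y(1) by auto
  qed
  then obtain y where yC: "\<And>n. y n \<in> C" and y: "\<And>n. (dist a (y n))\<^sup>2 < d\<^sup>2 + 1 / real (Suc n)"
    by metis
  have "Cauchy y"
  proof (rule Cauchy_if_dist_power_le)
    fix m n :: nat
    assume "m \<le> n"
    have "midpoint (y m) (y n) \<in> C"
      using convexD[OF assms(2) yC yC, of "1/2" "1/2"] by (simp add: midpoint_def scaleR_add_right)
    then have "d\<^sup>2 \<le> (dist a (midpoint (y m) (y n)))\<^sup>2"
      using lower d0 by (simp add: power_mono)
    moreover have "(dist (y m) (y n))\<^sup>2 =
        2 * (dist a (y m))\<^sup>2 + 2 * (dist a (y n))\<^sup>2 - 4 * (dist a (midpoint (y m) (y n)))\<^sup>2"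
      by (simp add: dist_norm power2_norm_eq_inner midpoint_def algebra_simps inner_commute)
    moreover have "1 / real (Suc n) \<le> 1 / real (Suc m)"
      using \<open>m \<le> n\<close> by (simp add: frac_le)
    ultimately show "(dist (y m) (y n))\<^sup>2 \<le> 4 * (1 / real (Suc m))"
      using y[of m] y[of n] by linarith
  next
    show "(\<lambda>m. 4 * (1 / real (Suc m))) \<longlonglongrightarrow> 0"
      using tendsto_mult_right_zero[OF LIMSEQ_inverse_real_of_nat] by (simp add: inverse_eq_divide)
  qed
  then obtain p where p: "y \<longlonglongrightarrow> p"
    using Cauchy_convergent convergent_def by blast
  have "p \<in> C"
    using closed_sequentially[OF assms(1) _ p] yC by blast
  have "(\<lambda>n. (dist a (y n))\<^sup>2) \<longlonglongrightarrow> (dist a p)\<^sup>2"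
    by (intro tendsto_intros p)
  moreover have "(\<lambda>n. d\<^sup>2 + 1 / real (Suc n)) \<longlonglongrightarrow> d\<^sup>2 + 0"
    using LIMSEQ_inverse_real_of_nat by (intro tendsto_intros) (simp add: inverse_eq_divide)
  ultimately have "(dist a p)\<^sup>2 \<le> d\<^sup>2 + 0"
    by (rule LIMSEQ_le) (use y in \<open>auto intro: less_imp_le\<close>)
  then have "dist a p \<le> d"
    using d0 by (simp add: power2_le_iff_abs_le)
  then show ?thesis
    using \<open>p \<in> C\<close> lower by (meson order_trans)
qed

lemma
  fixes C :: "'a::{real_inner, complete_space} set"
  assumes "closed C" "convex C" "C \<noteq> {}"
  shows metric_proj_in: "metric_proj C a \<in> C"
    and metric_proj_dot: "y \<in> C \<Longrightarrow> inner (a - metric_proj C a) (y - metric_proj C a) \<le> 0"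
proof -
  have "\<exists>!p. p \<in> C \<and> (\<forall>y\<in>C. dist a p \<le> dist a y)"
    using nearest_point_exists[OF assms] any_closest_point_unique[OF assms(2,1)] by blast
  then have P: "metric_proj C a \<in> C \<and> (\<forall>y\<in>C. dist a (metric_proj C a) \<le> dist a y)"
    unfolding metric_proj_def by (rule theI')
  then show "metric_proj C a \<in> C" by blast
  show "y \<in> C \<Longrightarrow> inner (a - metric_proj C a) (y - metric_proj C a) \<le> 0"
    using P any_closest_point_dot[OF assms(2,1)] by blast
qed

text \<open>
  The angle at the projection is obtuse, so the Pythagorean identity becomes an inequality.
\<close>

lemma metric_proj_pythagoras:
  fixes C :: "'a::{real_inner, complete_space} set"
  assumes "closed C" "convex C" "u \<in> C"
  shows "(norm (metric_proj C a - u))\<^sup>2 + (norm (a - metric_proj C a))\<^sup>2 \<le> (norm (a - u))\<^sup>2"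
proof -
  have "inner (a - metric_proj C a) (u - metric_proj C a) \<le> 0"
    using assms by (intro metric_proj_dot) auto
  then show ?thesis
    by (simp add: power2_norm_eq_inner algebra_simps inner_commute)
qed

section \<open>Asymptotic hulls as a substitute for weak cluster points\<close>

text \<open>
  The points of minimal norm have increasing norms, and by the obtuse-angle inequality the squared
  distance between two of them is at most the difference of their squared norms.  Hence they form
  a Cauchy sequence, and its limit lies in every set.
\<close>

lemma nested_closed_convex_Inter_nonempty:
  fixes C :: "nat \<Rightarrow> 'a::{real_inner, complete_space} set"
  assumes "\<And>n. closed (C n)" "\<And>n. convex (C n)" "\<And>n. C n \<noteq> {}"
    and nested: "\<And>m n. m \<le> n \<Longrightarrow> C n \<subseteq> C m"
    and bdd: "bounded (C 0)"
  shows "(\<Inter>n. C n) \<noteq> {}"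
proof -
  define y where "y n = metric_proj (C n) 0" for n
  have yC: "y n \<in> C m" if "m \<le> n" for m n
    using metric_proj_in[OF assms(1-3)] nested[OF that] unfolding y_def by blast
  have gap: "(dist (y m) (y n))\<^sup>2 \<le> (norm (y n))\<^sup>2 - (norm (y m))\<^sup>2" if "m \<le> n" for m n
    using metric_proj_pythagoras[OF assms(1,2) yC[OF that], of 0]
    by (simp add: y_def dist_norm)
  obtain B where B: "\<And>v. v \<in> C 0 \<Longrightarrow> norm v \<le> B"
    using bdd unfolding bounded_iff by blast
  have "incseq (\<lambda>n. (norm (y n))\<^sup>2)"
  proof (rule incseq_SucI)
    show "(norm (y n))\<^sup>2 \<le> (norm (y (Suc n)))\<^sup>2" for n
      using gap[of n "Suc n"] zero_le_power2[of "dist (y n) (y (Suc n))"] by linarith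
  qed
  moreover have "\<forall>n. (norm (y n))\<^sup>2 \<le> B\<^sup>2"
    using B yC by (simp add: power_mono)
  ultimately obtain L where L: "(\<lambda>n. (norm (y n))\<^sup>2) \<longlonglongrightarrow> L" "\<forall>n. (norm (y n))\<^sup>2 \<le> L"
    by (rule incseq_convergent)
  have "Cauchy y"
  proof (rule Cauchy_if_dist_power_le)
    show "(dist (y m) (y n))\<^sup>2 \<le> L - (norm (y m))\<^sup>2" if "m \<le> n" for m n
      using gap[OF that] L(2) by (smt (verit))
    show "(\<lambda>m. L - (norm (y m))\<^sup>2) \<longlonglongrightarrow> 0"
      using tendsto_diff[OF tendsto_const L(1), of L] by simp
  qed
  then obtain w where w: "y \<longlonglongrightarrow> w"
    using Cauchy_convergent convergent_def by blast
  have "w \<in> C m" for m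
  proof (rule Lim_in_closed_set[OF assms(1) _ _ w])
    show "eventually (\<lambda>n. y n \<in> C m) sequentially"
      using yC by (auto simp: eventually_sequentially)
  qed simp
  then show ?thesis by blast
qed

text \<open>
  Weak cluster points belong to this set, since closed convex sets are weakly closed.  Working with
  the set itself avoids having to extract weakly convergent subsequences.
\<close>

definition asymptotic_hull :: "(nat \<Rightarrow> 'a::real_normed_vector) \<Rightarrow> 'a set" where
  "asymptotic_hull x = (\<Inter>m. closure (convex hull (x ` {m..})))"

lemma asymptotic_hull_nonempty:
  fixes x :: "nat \<Rightarrow> 'a::{real_inner, complete_space}"
  assumes "bounded (range x)"
  shows "asymptotic_hull x \<noteq> {}"
  unfolding asymptotic_hull_def
proof (rule nested_closed_convex_Inter_nonempty)
  show "closure (convex hull (x ` {n..})) \<subseteq> closure (convex hull (x ` {m..}))" if "m \<le> n" for m n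
    using that by (intro closure_mono hull_mono image_mono) auto
  show "bounded (closure (convex hull (x ` {0..})))"
    using assms by (simp add: bounded_closure bounded_convex_hull atLeast_0)
qed (auto simp: convex_convex_hull)

lemma asymptotic_hull_subseq:
  assumes "strict_mono r"
  shows "asymptotic_hull (x \<circ> r) \<subseteq> asymptotic_hull x"
  unfolding asymptotic_hull_def
proof (rule INF_mono)
  fix m
  have "(x \<circ> r) ` {m..} \<subseteq> x ` {m..}"
    using seq_suble[OF assms] by (force intro: order_trans)
  then show "\<exists>n\<in>UNIV. closure (convex hull ((x \<circ> r) ` {n..})) \<subseteq> closure (convex hull (x ` {m..}))"
    by (meson UNIV_I closure_mono hull_mono)
qed

lemma asymptotic_hull_in_closed_convex:
  assumes "w \<in> asymptotic_hull x" "closed C" "convex C"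
    and ev: "eventually (\<lambda>n. x n \<in> C) sequentially"
  shows "w \<in> C"
proof -
  obtain m where "x ` {m..} \<subseteq> C"
    using ev by (auto simp: eventually_sequentially)
  then have "closure (convex hull (x ` {m..})) \<subseteq> C"
    using assms(2,3) by (intro closure_minimal hull_minimal)
  then show ?thesis
    using assms(1) unfolding asymptotic_hull_def by blast
qed

lemma asymptotic_hull_functional_le:
  fixes f :: "'a::real_normed_vector \<Rightarrow> real"
  assumes f: "bounded_linear f" and w: "w \<in> asymptotic_hull x"
    and ev: "eventually (\<lambda>n. f (x n) \<le> c) sequentially"
  shows "f w \<le> c"
proof -
  have "closed (f -` {..c})"
    using linear_continuous_on[OF f] by (intro closed_vimage) auto
  moreover have "convex (f -` {..c})"
    by (intro convex_linear_vimage bounded_linear.linear[OF f]) simp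
  ultimately have "w \<in> f -` {..c}"
    by (rule asymptotic_hull_in_closed_convex[OF w]) (use ev in simp)
  then show ?thesis by simp
qed

lemma asymptotic_hull_functional_limit:
  fixes f :: "'a::real_normed_vector \<Rightarrow> real"
  assumes f: "bounded_linear f" and w: "w \<in> asymptotic_hull x"
    and lim: "(\<lambda>n. f (x n)) \<longlonglongrightarrow> c"
  shows "f w = c"
proof (rule antisym)
  show "f w \<le> c"
  proof (rule field_le_epsilon)
    fix e :: real assume "0 < e"
    then have "eventually (\<lambda>n. f (x n) < c + e) sequentially"
      using lim by (intro order_tendstoD) auto
    then show "f w \<le> c + e"
      by (intro asymptotic_hull_functional_le[OF f w]) (auto elim: eventually_mono)
  qed
  have "- f w \<le> - c"
  proof (rule field_le_epsilon)
    fix e :: real assume "0 < e"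
    then have "eventually (\<lambda>n. c - e < f (x n)) sequentially"
      using lim by (intro order_tendstoD) auto
    then show "- f w \<le> - c + e"
      by (intro asymptotic_hull_functional_le[OF bounded_linear_minus[OF f] w])
        (auto elim: eventually_mono)
  qed
  then show "c \<le> f w" by simp
qed

text \<open>
  The obtuse-angle inequality at the projection \<open>q\<close> of \<open>w\<close> is an affine condition.  It holds on
  all of \<open>C\<close>, hence asymptotically along the sequence, hence at \<open>w\<close> itself; there it says \<open>w = q\<close>.
\<close>

lemma asymptotic_hull_in_approached_set:
  fixes C :: "'a::{real_inner, complete_space} set"
  assumes w: "w \<in> asymptotic_hull x" and C: "closed C" "convex C"
    and p: "\<And>n. p n \<in> C" and lim: "(\<lambda>n. x n - p n) \<longlonglongrightarrow> 0"
  shows "w \<in> C"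
proof -
  have ne: "C \<noteq> {}" using p by blast
  define q where "q = metric_proj C w"
  have qC: "q \<in> C"
    unfolding q_def by (rule metric_proj_in[OF C ne])
  have "inner (w - q) w \<le> inner (w - q) q"
  proof (rule field_le_epsilon)
    fix e :: real assume e: "0 < e"
    have "(\<lambda>n. inner (w - q) (x n - p n)) \<longlonglongrightarrow> inner (w - q) 0"
      by (intro tendsto_intros lim)
    then have "eventually (\<lambda>n. inner (w - q) (x n - p n) < e) sequentially"
      using e by (intro order_tendstoD) auto
    then have "eventually (\<lambda>n. inner (w - q) (x n) \<le> inner (w - q) q + e) sequentially"
    proof (rule eventually_mono)
      fix n assume "inner (w - q) (x n - p n) < e"
      moreover have "inner (w - q) (p n - q) \<le> 0"
        unfolding q_def by (rule metric_proj_dot[OF C ne p])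
      ultimately show "inner (w - q) (x n) \<le> inner (w - q) q + e"
        by (simp add: inner_diff_right)
    qed
    then show "inner (w - q) w \<le> inner (w - q) q + e"
      by (rule asymptotic_hull_functional_le[OF bounded_linear_inner_right w])
  qed
  then have "inner (w - q) (w - q) \<le> 0"
    by (simp add: inner_diff_right)
  then have "w - q = 0"
    by (metis inner_ge_zero inner_eq_zero_iff antisym)
  then show ?thesis using qC by simp
qed

section \<open>Weak and strong convergence of Fejer monotone sequences\<close>

text \<open>
  For \<open>z\<close> and \<open>w\<close> in \<open>K\<close> the difference of the squared distances from \<open>x n\<close> is affine in \<open>x n\<close> with
  linear part \<open>2 * inner (w - z) (x n)\<close>, so this inner product converges.  If \<open>z\<close> and \<open>w\<close> both
  belong to the asymptotic hull, the functional takes the same limiting value at them, whence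
  \<open>w = z\<close>.  Were \<open>z\<close> not the weak limit, some functional would separate it from the
  asymptotic hull of a subsequence; but that is nonempty and contained in the asymptotic hull
  of the sequence, which is \<open>{z}\<close>.
\<close>

lemma opial_weak_convergence:
  fixes x :: "nat \<Rightarrow> 'a::{real_inner, complete_space}"
  assumes "K \<noteq> {}"
    and conv: "\<And>u. u \<in> K \<Longrightarrow> convergent (\<lambda>n. norm (x n - u))"
    and sub: "asymptotic_hull x \<subseteq> K"
  shows "\<exists>z. weakly_converges x z"
proof -
  have bdd: "bounded (range x)"
  proof -
    obtain u where "u \<in> K" using assms(1) by blast
    then have "Bseq (\<lambda>n. norm (x n - u))"
      using conv convergent_imp_Bseq by blast
    then obtain B where "\<And>n. norm (x n - u) \<le> B"
      unfolding Bseq_def by auto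
    then have "norm (x n) \<le> norm u + B" for n
      using norm_triangle_sub[of "x n" u] by (meson add_left_mono order_trans)
    then show ?thesis
      by (intro boundedI) auto
  qed
  then obtain z where z: "z \<in> asymptotic_hull x"
    using asymptotic_hull_nonempty by blast
  have unique: "w = z" if w: "w \<in> asymptotic_hull x" for w
  proof -
    obtain lw where lw: "(\<lambda>n. norm (x n - w)) \<longlonglongrightarrow> lw"
      using conv sub w by (blast dest: convergentD)
    obtain lz where lz: "(\<lambda>n. norm (x n - z)) \<longlonglongrightarrow> lz"
      using conv sub z by (blast dest: convergentD)
    have "inner (w - z) (x n) =
        ((norm (x n - z))\<^sup>2 - (norm (x n - w))\<^sup>2 + (norm w)\<^sup>2 - (norm z)\<^sup>2) / 2" for n
      unfolding power2_norm_eq_inner by (simp add: algebra_simps inner_commute)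
    then have lim: "(\<lambda>n. inner (w - z) (x n)) \<longlonglongrightarrow> (lz\<^sup>2 - lw\<^sup>2 + (norm w)\<^sup>2 - (norm z)\<^sup>2) / 2"
      using lw lz by (simp only:) (intro tendsto_intros; simp)
    have "inner (w - z) w = inner (w - z) z"
      using asymptotic_hull_functional_limit[OF bounded_linear_inner_right _ lim] w z by metis
    then have "inner (w - z) (w - z) = 0"
      by (simp add: inner_diff_right)
    then show ?thesis by simp
  qed
  have upper: "eventually (\<lambda>n. f (x n) < f z + e) sequentially"
    if f: "bounded_linear f" and e: "0 < e" for f :: "'a \<Rightarrow> real" and e
  proof (rule ccontr)
    assume "\<not> ?thesis"
    then have "infinite {n. f z + e \<le> f (x n)}"
      by (simp add: not_eventually not_less frequently_cofinite flip: cofinite_eq_sequentially)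
    then obtain r :: "nat \<Rightarrow> nat" where r: "strict_mono r" "\<And>n. f z + e \<le> f (x (r n))"
      using infinite_enumerate by blast
    have "bounded (range (x \<circ> r))"
      using bdd by (rule bounded_subset) auto
    then obtain w where w: "w \<in> asymptotic_hull (x \<circ> r)"
      using asymptotic_hull_nonempty by blast
    then have "w = z"
      using unique asymptotic_hull_subseq[OF r(1)] by blast
    moreover have "eventually (\<lambda>n. - f ((x \<circ> r) n) \<le> - (f z + e)) sequentially"
    proof (rule always_eventually, rule allI)
      show "- f ((x \<circ> r) n) \<le> - (f z + e)" for n
        using r(2)[of n] by simp
    qed
    then have "- f w \<le> - (f z + e)"
      by (rule asymptotic_hull_functional_le[OF bounded_linear_minus[OF f] w])
    ultimately show False using e by simp
  qed
  have "(\<lambda>n. f (x n)) \<longlonglongrightarrow> f z" if f: "bounded_linear f" for f :: "'a \<Rightarrow> real"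
  proof (rule order_tendstoI)
    show "eventually (\<lambda>n. f (x n) < c) sequentially" if "f z < c" for c
      using upper[OF f, of "c - f z"] that by simp
    show "eventually (\<lambda>n. c < f (x n)) sequentially" if "c < f z" for c
      using upper[OF bounded_linear_minus[OF f], of "f z - c"] that by simp
  qed
  then show ?thesis
    unfolding weakly_converges_def by blast
qed

text \<open>
  Testing monotonicity against \<open>u - r *\<^sub>R v\<close>, where \<open>v\<close> is the unit vector from \<open>x m\<close> to \<open>x n\<close>,
  rather than against \<open>u\<close> gains a term proportional to the distance of \<open>x m\<close> and \<open>x n\<close>:
  the squared distances to \<open>u\<close> bound the distances of the iterates to the first power.
\<close>

lemma fejer_ball_Cauchy:
  fixes x :: "nat \<Rightarrow> 'a::real_inner"
  assumes fejer: "\<And>c m n. c \<in> cball u r \<Longrightarrow> m \<le> n \<Longrightarrow> norm (x n - c) \<le> norm (x m - c)"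
    and r: "0 < r"
  shows "Cauchy x"
proof -
  have uc: "u \<in> cball u r" using r by simp
  have gap: "dist (x m) (x n) \<le> ((norm (x m - u))\<^sup>2 - (norm (x n - u))\<^sup>2) / (2 * r)"
    if mn: "m \<le> n" for m n
  proof -
    \<comment> \<open>If \<open>x n = x m\<close>, then \<open>v = 0\<close> and the computation below remains valid.\<close>
    define v where "v = sgn (x n - x m)"
    have "u - r *\<^sub>R v \<in> cball u r"
      using r by (simp add: v_def dist_norm norm_sgn)
    then have "(norm (x n - (u - r *\<^sub>R v)))\<^sup>2 \<le> (norm (x m - (u - r *\<^sub>R v)))\<^sup>2"
      using fejer mn by (simp add: power_mono)
    moreover have "(norm (y - (u - r *\<^sub>R v)))\<^sup>2 =
        (norm (y - u))\<^sup>2 + 2 * r * inner v (y - u) + r\<^sup>2 * (norm v)\<^sup>2" for y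
      unfolding power2_norm_eq_inner by (simp add: algebra_simps inner_commute power2_eq_square)
    ultimately have "2 * r * inner v (x n - u) - 2 * r * inner v (x m - u)
        \<le> (norm (x m - u))\<^sup>2 - (norm (x n - u))\<^sup>2"
      by simp
    then have "2 * r * inner v (x n - x m) \<le> (norm (x m - u))\<^sup>2 - (norm (x n - u))\<^sup>2"
      by (simp add: inner_diff_right algebra_simps)
    moreover have "inner v (x n - x m) = norm (x n - x m)"
      by (cases "x n = x m") (simp_all add: v_def sgn_div_norm dot_square_norm power2_eq_square)
    moreover have "norm (x n - x m) = dist (x m) (x n)"
      by (metis dist_commute dist_norm)
    ultimately show ?thesis
      using r by (simp add: field_simps)
  qed
  have "decseq (\<lambda>n. (norm (x n - u))\<^sup>2)"
    by (rule decseq_SucI) (simp add: fejer[OF uc] power_mono)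
  then obtain L where L: "(\<lambda>n. (norm (x n - u))\<^sup>2) \<longlonglongrightarrow> L" "\<forall>n. L \<le> (norm (x n - u))\<^sup>2"
    by (rule decseq_convergent[where B = 0]) auto
  show ?thesis
  proof (rule Cauchy_if_dist_power_le)
    show "dist (x m) (x n) ^ 1 \<le> ((norm (x m - u))\<^sup>2 - L) / (2 * r)" if "m \<le> n" for m n
      using gap[OF that] L(2)[rule_format, of n] r by (simp add: field_simps)
    have "(\<lambda>m. ((norm (x m - u))\<^sup>2 - L) / (2 * r)) \<longlonglongrightarrow> (L - L) / (2 * r)"
      using r by (intro tendsto_intros L(1)) auto
    then show "(\<lambda>m. ((norm (x m - u))\<^sup>2 - L) / (2 * r)) \<longlonglongrightarrow> 0" by simp
  qed
qed

lemma weak_limit_eq_limit: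
  fixes x :: "nat \<Rightarrow> 'a::real_inner"
  assumes weak: "weakly_converges x z" and "x \<longlonglongrightarrow> y"
  shows "y = z"
proof -
  have "(\<lambda>n. inner (y - z) (x n)) \<longlonglongrightarrow> inner (y - z) z"
    using weak bounded_linear_inner_right unfolding weakly_converges_def by blast
  moreover have "(\<lambda>n. inner (y - z) (x n)) \<longlonglongrightarrow> inner (y - z) y"
    by (intro tendsto_intros assms(2))
  ultimately have "inner (y - z) z = inner (y - z) y"
    by (rule LIMSEQ_unique)
  then have "inner (y - z) (y - z) = 0"
    by (simp add: inner_diff_right)
  then show ?thesis by simp
qed

lemma orthogonal_expansion:
  fixes C :: "'a::real_inner set"
  assumes "finite C" "pairwise orthogonal C" "v \<in> span C"
  shows "(\<Sum>c\<in>C. (inner c v / inner c c) *\<^sub>R c) = v"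
proof (rule vector_eq_dot_span[OF _ assms(3)])
  show "(\<Sum>c\<in>C. (inner c v / inner c c) *\<^sub>R c) \<in> span C"
    by (intro span_sum span_scale span_base)
  fix i assume i: "i \<in> C"
  have "inner i (\<Sum>c\<in>C. (inner c v / inner c c) *\<^sub>R c)
      = (\<Sum>c\<in>C. inner c v / inner c c * inner i c)"
    by (simp add: inner_sum_right)
  also have "\<dots> = (\<Sum>c\<in>C. if c = i then inner i v else 0)"
  proof (rule sum.cong[OF refl])
    fix c assume c: "c \<in> C"
    show "inner c v / inner c c * inner i c = (if c = i then inner i v else 0)"
      using assms(2) i c by (cases "c = i") (auto simp: pairwise_def orthogonal_def)
  qed
  also have "\<dots> = inner i v"
    using assms(1) i by simp
  finally show "inner i (\<Sum>c\<in>C. (inner c v / inner c c) *\<^sub>R c) = inner i v" .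
qed

lemma weak_imp_strong_finite_dim:
  fixes x :: "nat \<Rightarrow> 'a::real_inner"
  assumes weak: "weakly_converges x z" and B: "finite B" "span B = (UNIV :: 'a set)"
  shows "x \<longlonglongrightarrow> z"
proof -
  obtain C :: "'a set" where C: "finite C" "span C = UNIV" "pairwise orthogonal C"
    using basis_orthogonal[OF B(1)] B(2) by metis
  note expand = orthogonal_expansion[OF C(1,3)]
  have "(\<lambda>n. \<Sum>c\<in>C. (inner c (x n) / inner c c) *\<^sub>R c) \<longlonglongrightarrow> (\<Sum>c\<in>C. (inner c z / inner c c) *\<^sub>R c)"
  proof (rule tendsto_sum)
    fix c :: 'a
    have "bounded_linear (\<lambda>v. inner c v / inner c c)"
      by (intro bounded_linear_compose[OF bounded_linear_divide] bounded_linear_inner_right)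
    then have "(\<lambda>n. inner c (x n) / inner c c) \<longlonglongrightarrow> inner c z / inner c c"
      using weak unfolding weakly_converges_def by blast
    then show "(\<lambda>n. (inner c (x n) / inner c c) *\<^sub>R c) \<longlonglongrightarrow> (inner c z / inner c c) *\<^sub>R c"
      by (intro tendsto_scaleR tendsto_const)
  qed
  then show ?thesis
    using expand C(2) by simp
qed

section \<open>The modified alternating projection algorithm\<close>

lemma projection_halfspace_contains:
  fixes K :: "nat \<Rightarrow> 'a::{real_inner, complete_space} set"
  assumes "closed (K j)" "convex (K j)" "u \<in> K j"
  shows "inner (pa K x i j) u \<le> pb K x i j"
proof -
  have "K j \<noteq> {}" using assms(3) by blast
  from metric_proj_dot[OF assms(1,2) this assms(3), of "x (i - 1)"] show ?thesis
    by (simp add: pa_def pb_def px_def inner_diff_right)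
qed

lemma F_set_closed_convex_superset:
  fixes K :: "nat \<Rightarrow> 'a::{real_inner, complete_space} set"
  assumes "closed (K 1)" "convex (K 1)" "closed (K 2)" "convex (K 2)"
    and J: "J i = {par i} \<or> J i = {1, 2}" and "i \<ge> 1"
  shows "closed (F_set K J x i)" "convex (F_set K J x i)" "K 1 \<inter> K 2 \<subseteq> F_set K J x i"
proof -
  have half: "closed {y. inner a y \<le> b}" "convex {y. inner a y \<le> b}" for a :: 'a and b
    by (simp_all add: closed_halfspace_le convex_halfspace_le)
  note both = closed_Int[OF half(1) half(1)] convex_Int[OF half(2) half(2)]
  have in1: "inner (pa K x l 1) u \<le> pb K x l 1" and in2: "inner (pa K x l 2) u \<le> pb K x l 2"
    if "u \<in> K 1 \<inter> K 2" for u l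
    using that assms(1-4) projection_halfspace_contains by blast+
  have inp: "inner (pa K x l (par l)) u \<le> pb K x l (par l)" if "u \<in> K 1 \<inter> K 2" for u l
    using in1 in2 that by (simp add: par_def)
  have ne: "{1, 2} \<noteq> {par i}" by (simp add: doubleton_eq_iff par_def)
  consider "J i = {par i}" "i > 1" | "J i = {par i}" "i = 1" | "J i = {1, 2}"
    using J \<open>i \<ge> 1\<close> by linarith
  then have "closed (F_set K J x i) \<and> convex (F_set K J x i) \<and> K 1 \<inter> K 2 \<subseteq> F_set K J x i"
  proof cases
    case 1
    then have F: "F_set K J x i = {y. inner (pa K x (i - 1) (par (i - 1))) y \<le> pb K x (i - 1) (par (i - 1))}
        \<inter> {y. inner (pa K x i (par i)) y \<le> pb K x i (par i)}"
      by (auto simp: F_set_def)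
    show ?thesis unfolding F using both inp by blast
  next
    case 2
    then have F: "F_set K J x i = {y. inner (pa K x 1 1) y \<le> pb K x 1 1}"
      by (auto simp: F_set_def)
    show ?thesis unfolding F using half in1 by blast
  next
    case 3
    then have "J i \<noteq> {par i}" using ne by simp
    with 3 have "F_set K J x i = {y. \<forall>j\<in>{1, 2}. inner (pa K x i j) y \<le> pb K x i j}"
      unfolding F_set_def by (simp only: if_True if_False simp_thms)
    then have F: "F_set K J x i = {y. inner (pa K x i 1) y \<le> pb K x i 1}
        \<inter> {y. inner (pa K x i 2) y \<le> pb K x i 2}"
      by (simp add: Collect_conj_eq)
    show ?thesis unfolding F using both in1 in2 by blast
  qed
  then show "closed (F_set K J x i)" "convex (F_set K J x i)" "K 1 \<inter> K 2 \<subseteq> F_set K J x i"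
    by auto
qed

text \<open>
  Both sets projected onto in a step contain \<open>u\<close>, so the obtuse-angle inequalities of the two
  projections can be added.
\<close>

lemma map_iterates_step:
  fixes K :: "nat \<Rightarrow> 'a::{real_inner, complete_space} set"
  assumes K: "closed (K 1)" "convex (K 1)" "closed (K 2)" "convex (K 2)"
    and J: "\<forall>i\<ge>1. J i = {par i} \<or> J i = {1, 2}"
    and x: "map_iterates K J x0 x" and u: "u \<in> K 1 \<inter> K 2"
  defines "q \<equiv> \<lambda>i. px K x i (par i)"
  shows "(norm (x (Suc i) - u))\<^sup>2 + (norm (q (Suc i) - x (Suc i)))\<^sup>2 + (norm (x i - q (Suc i)))\<^sup>2
    \<le> (norm (x i - u))\<^sup>2"
proof -
  have xS: "x (Suc i) = metric_proj (F_set K J x (Suc i)) (q (Suc i))"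
    using x by (auto simp: map_iterates_def q_def)
  have F: "closed (F_set K J x (Suc i))" "convex (F_set K J x (Suc i))" "u \<in> F_set K J x (Suc i)"
    using F_set_closed_convex_superset[OF K, of J "Suc i" x] J u by auto
  have "closed (K (par (Suc i)))" "convex (K (par (Suc i)))" "u \<in> K (par (Suc i))"
    using K u by (auto simp: par_def)
  from metric_proj_pythagoras[OF this, of "x i"]
  have "(norm (q (Suc i) - u))\<^sup>2 + (norm (x i - q (Suc i)))\<^sup>2 \<le> (norm (x i - u))\<^sup>2"
    by (simp add: q_def px_def)
  moreover from metric_proj_pythagoras[OF F, of "q (Suc i)"]
  have "(norm (x (Suc i) - u))\<^sup>2 + (norm (q (Suc i) - x (Suc i)))\<^sup>2 \<le> (norm (q (Suc i) - u))\<^sup>2"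
    by (simp add: xS)
  ultimately show ?thesis by linarith
qed

theorem theorem4p5:
  fixes K :: "nat \<Rightarrow> 'a::{real_inner, complete_space} set"
    and J :: "nat \<Rightarrow> nat set"
    and x0 :: 'a
    and x :: "nat \<Rightarrow> 'a"
  assumes "closed (K 1)" and "convex (K 1)"
    and "closed (K 2)" and "convex (K 2)"
    and "K 1 \<inter> K 2 \<noteq> {}"
    and "(\<forall>i\<ge>1. J i = {par i}) \<or> (\<forall>i\<ge>1. J i = {1, 2})"
    and "map_iterates K J x0 x"
  shows "\<exists>z. weakly_converges x z \<and>
    (interior (K 1 \<inter> K 2) \<noteq> {} \<or> (\<exists>B::'a set. finite B \<and> span B = UNIV) \<longrightarrow> x \<longlonglongrightarrow> z)"
proof -
  define q where "q i = px K x i (par i)" for i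
  have J: "\<forall>i\<ge>1. J i = {par i} \<or> J i = {1, 2}"
    using assms(6) by blast
  note step = map_iterates_step[OF assms(1-4) J assms(7), folded q_def]
  have mono: "norm (x (Suc i) - u) \<le> norm (x i - u)" if "u \<in> K 1 \<inter> K 2" for u i
  proof (rule power2_le_imp_le)
    show "(norm (x (Suc i) - u))\<^sup>2 \<le> (norm (x i - u))\<^sup>2"
      using step[OF that, of i] zero_le_power2[of "norm (q (Suc i) - x (Suc i))"]
        zero_le_power2[of "norm (x i - q (Suc i))"] by linarith
  qed simp
  have dec: "decseq (\<lambda>i. norm (x i - u))" if "u \<in> K 1 \<inter> K 2" for u
    using mono[OF that] by (rule decseq_SucI)
  have conv: "convergent (\<lambda>i. norm (x i - u))" if u: "u \<in> K 1 \<inter> K 2" for u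
  proof -
    obtain l where "(\<lambda>i. norm (x i - u)) \<longlonglongrightarrow> l"
      by (rule decseq_convergent[OF dec[OF u], of 0]) simp
    then show ?thesis by (rule convergentI)
  qed
  have lims: "(\<lambda>i. x (Suc i) - q (Suc i)) \<longlonglongrightarrow> 0" "(\<lambda>i. x i - q (Suc i)) \<longlonglongrightarrow> 0"
  proof -
    obtain u where u: "u \<in> K 1 \<inter> K 2" using assms(5) by blast
    define g where "g i = (norm (x i - u))\<^sup>2 - (norm (x (Suc i) - u))\<^sup>2" for i
    obtain l where l: "(\<lambda>i. norm (x i - u)) \<longlonglongrightarrow> l"
      using convergentD[OF conv[OF u]] by blast
    have "g \<longlonglongrightarrow> l\<^sup>2 - l\<^sup>2"
      unfolding g_def by (intro tendsto_intros l LIMSEQ_Suc[OF l])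
    then have "(\<lambda>i. sqrt (g i)) \<longlonglongrightarrow> sqrt (l\<^sup>2 - l\<^sup>2)"
      by (rule tendsto_real_sqrt)
    then have g0: "(\<lambda>i. sqrt (g i)) \<longlonglongrightarrow> 0" by simp
    have "(norm (x (Suc i) - q (Suc i)))\<^sup>2 \<le> g i" for i
      using step[OF u, of i] zero_le_power2[of "norm (x i - q (Suc i))"]
      unfolding g_def norm_minus_commute[of "q (Suc i)"] by linarith
    moreover have "(norm (x i - q (Suc i)))\<^sup>2 \<le> g i" for i
      using step[OF u, of i] zero_le_power2[of "norm (q (Suc i) - x (Suc i))"]
      unfolding g_def by linarith
    ultimately show "(\<lambda>i. x (Suc i) - q (Suc i)) \<longlonglongrightarrow> 0" "(\<lambda>i. x i - q (Suc i)) \<longlonglongrightarrow> 0"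
      by (intro Lim_null_comparison[OF always_eventually g0] allI real_le_rsqrt; simp)+
  qed
  have qK: "q i \<in> K (par i)" for i
    unfolding q_def px_def using assms(1-5) by (intro metric_proj_in) (auto simp: par_def)
  have hull: "asymptotic_hull x \<subseteq> K j" if j: "j = 1 \<or> j = 2" for j
  proof
    fix w assume w: "w \<in> asymptotic_hull x"
    \<comment> \<open>Of the two consecutive projections \<open>q n\<close>, \<open>q (Suc n)\<close> one is onto \<open>K j\<close>,
      and both are asymptotically close to \<open>x n\<close>.\<close>
    define p where "p n = (if par n = j then q n else q (Suc n))" for n
    have "p n \<in> K j" for n
      using qK[of n] qK[of "Suc n"] j by (auto simp: p_def par_def split: if_splits)
    moreover have "(\<lambda>n. x n - p n) \<longlonglongrightarrow> 0"
    proof (rule Lim_null_comparison)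
      show "eventually (\<lambda>n. norm (x n - p n) \<le> norm (x n - q n) + norm (x n - q (Suc n))) sequentially"
        by (auto simp: p_def)
      have "(\<lambda>n. x n - q n) \<longlonglongrightarrow> 0"
        using lims(1) by (rule LIMSEQ_imp_Suc)
      then show "(\<lambda>n. norm (x n - q n) + norm (x n - q (Suc n))) \<longlonglongrightarrow> 0"
        using lims(2) by (intro tendsto_add_zero tendsto_norm_zero)
    qed
    ultimately show "w \<in> K j"
      using assms(1-4) j by (intro asymptotic_hull_in_approached_set[OF w]) auto
  qed
  obtain z where z: "weakly_converges x z"
    using opial_weak_convergence[OF assms(5) conv] hull[of 1] hull[of 2] by blast
  have "x \<longlonglongrightarrow> z" if int: "interior (K 1 \<inter> K 2) \<noteq> {}"
  proof -
    obtain u r where r: "0 < r" "cball u r \<subseteq> K 1 \<inter> K 2"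
      using int by (metis ex_in_conv mem_interior_cball)
    have "Cauchy x"
    proof (rule fejer_ball_Cauchy[OF _ r(1)])
      show "norm (x n - c) \<le> norm (x m - c)" if "c \<in> cball u r" "m \<le> n" for c m n
        by (rule decseqD[OF dec that(2)]) (use r(2) that(1) in blast)
    qed
    then obtain y where "x \<longlonglongrightarrow> y"
      using Cauchy_convergent convergent_def by blast
    then show ?thesis
      using weak_limit_eq_limit[OF z] by blast
  qed
  then show ?thesis
    using z weak_imp_strong_finite_dim[OF z] by blast
qed

end
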